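(* For all positive integers $k,n$, $$\sum_{i=1}^{n}M_{2i}^{(k)}=\frac{2^{2k}M_n^{(2k)}-n}{M_k} .$$
   Context: The Mersenne numbers $\{M_n\}_{n\ge 0}$ are defined by $M_0=0$, $M_1=1$, $M_{n+2}=3M_{n+1}-2M_n$, i.e. $M_n=2^n-1$. For a positive integer $k$, the higher order Mersenne numbers are $M_n^{(k)}=M_{kn}/M_k$ for $n=0,1,2,\dots$ (so $M_n^{(2k)}=M_{2kn}/M_{2k}$). *)

theory Defs
  imports Complex_Main
begin

fun mersenne :: "nat \<Rightarrow> int" where
  "mersenne 0 = 0"
| "mersenne (Suc 0) = 1"
| "mersenne (Suc (Suc n)) = 3 * mersenne (Suc n) - 2 * mersenne n"

lemma mersenne_closed_form: "mersenne n = 2 ^ n - 1"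
  by (induction n rule: mersenne.induct) simp_all

(* mersenne_ho k n is M_n^(k): the order k comes first.  The quotient is taken
   in the rationals; only k > 0 is meaningful, since mersenne 0 = 0. *)
definition mersenne_ho :: "nat \<Rightarrow> nat \<Rightarrow> rat" where
  "mersenne_ho k n = of_int (mersenne (k * n)) / of_int (mersenne k)"

end

theory Submission
  imports Defs
begin

text \<open>Put \<open>q = 2 ^ (2 * k)\<close>. Since 2^(k * 2i) = q^i, each summand is (q^i - 1) /
  M_k, while the number of order 2k at n is (q^n - 1) / (q - 1), itself the geometric sum 1 + q +
  ... + q^(n-1). Adding the numerators therefore gives q times that number, minus n.\<close>

lemma sum_power_from_1:
  fixes q :: "'a :: field"
  assumes "q \<noteq> 1"
  shows "(\<Sum>i=1..n. q ^ i) = q * ((q ^ n - 1) / (q - 1))"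
proof -
  have "(\<Sum>i=1..n. q ^ i) = q * (\<Sum>i<n. q ^ i)"
    by (simp add: sum.atLeast1_atMost_eq sum_distrib_left)
  then show ?thesis
    using assms by (simp add: geometric_sum)
qed

theorem theorem2p18:
  fixes k n :: nat
  assumes "k > 0" and "n > 0"
  shows "(\<Sum>i=1..n. mersenne_ho k (2 * i)) =
    (2 ^ (2 * k) * mersenne_ho (2 * k) n - of_nat n) / of_int (mersenne k)"
proof -
  define q :: rat where "q = 2 ^ (2 * k)"
  \<comment> \<open>Positivity of \<open>k\<close> enters here: the geometric sum formula needs a
    ratio other than 1.\<close>
  have "q > 1"
    unfolding q_def using assms(1) by (intro one_less_power) auto
  have even_terms: "mersenne_ho k (2 * i) = (q ^ i - 1) / of_int (mersenne k)" for i
    by (simp add: mersenne_ho_def mersenne_closed_form q_def power_mult [symmetric] ac_simps)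
  have double_order: "mersenne_ho (2 * k) n = (q ^ n - 1) / (q - 1)"
    by (simp add: mersenne_ho_def mersenne_closed_form q_def power_mult)
  have "(\<Sum>i=1..n. mersenne_ho k (2 * i)) = ((\<Sum>i=1..n. q ^ i) - of_nat n) / of_int (mersenne k)"
    by (simp add: even_terms sum_divide_distrib [symmetric] sum_subtractf)
  \<comment> \<open>The exponents start at 1 rather than 0, which produces the factor
    \<open>2 ^ (2 * k)\<close> of the claim.\<close>
  also have "(\<Sum>i=1..n. q ^ i) = q * mersenne_ho (2 * k) n"
    unfolding double_order using \<open>q > 1\<close> by (intro sum_power_from_1) simp
  finally show ?thesis
    by (simp add: q_def)
qed

end
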